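(* Let $S$ be a bounded semilattice such that the graph $G(S)$ is a path. Then either $G(S)=K_2$ or $G(S)=K_{1,2}$.
   Context: A bounded semilattice $(S,\cdot,0,1)$ is a commutative semigroup whose operation is idempotent ($x\cdot x=x$ for all $x$), with a neutral element $1$ and an absorbing element $0$ ($x\cdot 0=0$ for all $x$); it is partially ordered by $x\le y \iff x\cdot y=x$, so that $0\le x\le 1$. The graph $G(S)$ is the simple graph with vertex set $S\setminus\{0,1\}$ in which two vertices $x,y$ are adjacent iff $x\ne y$ and $x\cdot y\neq 0$. A path is a simple graph whose vertices can be arranged in a linear sequence in such a way that two vertices are adjacent if they are consecutive in the sequence, and are nonadjacent otherwise. $K_2$ is the complete graph on two vertices; $K_{1,2}$ is the complete bipartite graph with parts of sizes $1$ and $2$. Equality of graphs is meant up to isomorphism.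
   Formalization: The path G(S) is assumed to have at least two vertices; without this the claim fails, e.g. for the chain 0 < a < 1, where G(S) is a single vertex, or for S = {0, 1}, where G(S) is empty. *)

theory Defs
  imports "Graph_Theory.Graph_Theory"
begin

locale bounded_semilattice = semilattice_neutr f one
  for f :: "'a \<Rightarrow> 'a \<Rightarrow> 'a" (infixl \<open>\<^bold>*\<close> 70)
  and one :: 'a (\<open>\<^bold>1\<close>) +
  fixes zero :: 'a (\<open>\<^bold>0\<close>)
  assumes zero_right: "x \<^bold>* \<^bold>0 = \<^bold>0"

(* An undirected edge {x, y} is represented by the two arcs (x, y) and (y, x), as in the
   library's locale graph.  The semilattice, hence the vertex set, may be infinite. *)
definition semilattice_graph :: "('a \<Rightarrow> 'a \<Rightarrow> 'a) \<Rightarrow> 'a \<Rightarrow> 'a \<Rightarrow> ('a, 'a \<times> 'a) pre_digraph" where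
  "semilattice_graph f one zero = with_proj
    \<lparr> pverts = UNIV - {zero, one},
      parcs = {(x, y). x \<in> UNIV - {zero, one} \<and> y \<in> UNIV - {zero, one} \<and>
                       x \<noteq> y \<and> f x y \<noteq> zero} \<rparr>"

(* The graph as a whole is a path, as opposed to containing one (cf. apath).  Paths are finite;
   the graphs with no vertex and with one vertex satisfy this definition. *)
definition path_graph :: "('a, 'b) pre_digraph \<Rightarrow> bool" where
  "path_graph G \<longleftrightarrow> graph G \<and>
    (\<exists>vs. distinct vs \<and> set vs = verts G \<and>
      (\<forall>i < length vs. \<forall>j < length vs.
        vs ! i \<rightarrow>\<^bsub>G\<^esub> vs ! j \<longleftrightarrow> j = Suc i \<or> i = Suc j))"

end

(* For adjacent x, y the product xy is a vertex adjacent or equal to both, so in the absence of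
   triangles xy is x or y: adjacent vertices are comparable.  Let a - b - c - d be an induced path.
   Then a < b, since b < a would give bc <= ac = 0; by symmetry d < c.  Now b < c gives
   a = ac = 0, and c < b gives d = bd = 0, so a path has at most three vertices. *)
theory Submission
  imports Defs
begin

lemma verts_semilattice_graph [simp]: "verts (semilattice_graph f one zero) = UNIV - {zero, one}"
  by (simp add: semilattice_graph_def)

lemma semilattice_graph_dominates_iff:
  "x \<rightarrow>\<^bsub>semilattice_graph f one zero\<^esub> y \<longleftrightarrow>
    x \<notin> {zero, one} \<and> y \<notin> {zero, one} \<and> x \<noteq> y \<and> f x y \<noteq> zero"
  by (simp add: semilattice_graph_def)

context bounded_semilattice
begin

abbreviation "\<G> \<equiv> semilattice_graph f \<^bold>1 \<^bold>0"

lemma zero_left: "\<^bold>0 \<^bold>* x = \<^bold>0"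
  using zero_right by (simp add: commute)

lemma prod_eq_one: "x \<^bold>* y = \<^bold>1 \<Longrightarrow> x = \<^bold>1"
  by (metis left_idem right_neutral)

lemma dominates_comparable:
  assumes "x \<rightarrow>\<^bsub>\<G>\<^esub> y" and "\<And>z. \<not> (x \<rightarrow>\<^bsub>\<G>\<^esub> z \<and> y \<rightarrow>\<^bsub>\<G>\<^esub> z)"
  shows "x \<^bold>* y = x \<or> x \<^bold>* y = y"
proof (rule ccontr)
  assume neq: "\<not> ?thesis"
  have "x \<^bold>* (x \<^bold>* y) = x \<^bold>* y" "y \<^bold>* (x \<^bold>* y) = x \<^bold>* y"
    by (simp_all add: left_commute)
  \<comment> \<open>By the two equations, the product of \<open>x\<close> or \<open>y\<close> with
    xy is xy itself, which is nonzero since \<open>x\<close> and \<open>y\<close> are adjacent;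
    \<open>prod_eq_one\<close> rules out xy = 1. So xy is a vertex, and a common neighbour of
    \<open>x\<close> and \<open>y\<close> if it differs from both.\<close>
  then have "x \<rightarrow>\<^bsub>\<G>\<^esub> (x \<^bold>* y) \<and> y \<rightarrow>\<^bsub>\<G>\<^esub> (x \<^bold>* y)"
    using assms(1) neq prod_eq_one[of x y] by (auto simp: semilattice_graph_dominates_iff)
  with assms(2) show False by blast
qed

lemma no_induced_path4:
  assumes triangle_free: "\<And>x y z. \<lbrakk>x \<rightarrow>\<^bsub>\<G>\<^esub> y; x \<rightarrow>\<^bsub>\<G>\<^esub> z; y \<rightarrow>\<^bsub>\<G>\<^esub> z\<rbrakk> \<Longrightarrow> False"
    and adj: "a \<rightarrow>\<^bsub>\<G>\<^esub> b" "b \<rightarrow>\<^bsub>\<G>\<^esub> c" "c \<rightarrow>\<^bsub>\<G>\<^esub> d"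
    and nonadj: "\<not> a \<rightarrow>\<^bsub>\<G>\<^esub> c" "\<not> b \<rightarrow>\<^bsub>\<G>\<^esub> d"
    and "a \<noteq> c" "b \<noteq> d"
  shows False
proof -
  have comparable: "x \<^bold>* y = x \<or> x \<^bold>* y = y" if "x \<rightarrow>\<^bsub>\<G>\<^esub> y" for x y
    using dominates_comparable[OF that] triangle_free[OF that] by blast
  \<comment> \<open>No vertex is adjacent to itself, so non-adjacency yields a zero product only
    together with distinctness.\<close>
  have nz: "a \<noteq> \<^bold>0" "d \<noteq> \<^bold>0" "b \<^bold>* c \<noteq> \<^bold>0"
    and z: "a \<^bold>* c = \<^bold>0" "b \<^bold>* d = \<^bold>0"
    using assms by (auto simp: semilattice_graph_dominates_iff)
  have "a \<^bold>* b \<noteq> b"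
    using nz z by (metis assoc commute zero_left)
  then have ab: "a \<^bold>* b = a"
    using comparable adj by blast
  \<comment> \<open>The mirror image under a - b - c - d to d - c - b - a: if cd = c, then bc =
    b(cd) = (bd)c = 0.\<close>
  have "c \<^bold>* d \<noteq> c"
    using nz z by (metis assoc commute zero_left)
  then have cd: "c \<^bold>* d = d"
    using comparable adj by blast
  \<comment> \<open>If bc = b, then a = ab = a(bc) = (ab)c = ac = 0; if bc = c, then d = cd = (bc)d
    = b(cd) = bd = 0.\<close>
  have "b \<^bold>* c \<noteq> b"
    using ab nz z by (metis assoc)
  moreover have "b \<^bold>* c \<noteq> c"
    using cd nz z by (metis assoc)
  ultimately show False
    using comparable adj by blast
qed

lemma path_length_le_3:
  assumes "distinct vs"
    and set_vs: "set vs = verts \<G>"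
    and path: "\<And>i j. \<lbrakk>i < length vs; j < length vs\<rbrakk> \<Longrightarrow>
        vs ! i \<rightarrow>\<^bsub>\<G>\<^esub> vs ! j \<longleftrightarrow> j = Suc i \<or> i = Suc j"
  shows "length vs \<le> 3"
proof (rule ccontr)
  assume len: "\<not> ?thesis"
  have triangle_free: False if "x \<rightarrow>\<^bsub>\<G>\<^esub> y" "x \<rightarrow>\<^bsub>\<G>\<^esub> z" "y \<rightarrow>\<^bsub>\<G>\<^esub> z" for x y z
  proof -
    have "x \<in> set vs" "y \<in> set vs" "z \<in> set vs"
      using that set_vs by (auto simp: semilattice_graph_dominates_iff)
    then obtain i j k where "i < length vs" "j < length vs" "k < length vs"
      "x = vs ! i" "y = vs ! j" "z = vs ! k"
      by (metis in_set_conv_nth)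
    \<comment> \<open>Adjacent positions have opposite parity, which three positions cannot have
      pairwise.\<close>
    then show False
      using that path[of i j] path[of i k] path[of j k] by auto
  qed
  \<comment> \<open>The simplifier rewrites \<open>0 < length vs\<close> to this form when it
    discharges the bounds in \<open>path\<close> for the first four vertices.\<close>
  have "vs \<noteq> []"
    using len by auto
  show False
  proof (rule no_induced_path4)
    show "vs ! 0 \<rightarrow>\<^bsub>\<G>\<^esub> vs ! 1" "vs ! 1 \<rightarrow>\<^bsub>\<G>\<^esub> vs ! 2" "vs ! 2 \<rightarrow>\<^bsub>\<G>\<^esub> vs ! 3"
      "\<not> vs ! 0 \<rightarrow>\<^bsub>\<G>\<^esub> vs ! 2" "\<not> vs ! 1 \<rightarrow>\<^bsub>\<G>\<^esub> vs ! 3"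
      using len \<open>vs \<noteq> []\<close> by (simp_all add: path)
    show "vs ! 0 \<noteq> vs ! 2" "vs ! 1 \<noteq> vs ! 3"
      using len \<open>vs \<noteq> []\<close> \<open>distinct vs\<close> by (simp_all add: nth_eq_iff_index_eq)
  qed (fact triangle_free)
qed

end

text \<open>The cardinality bound excludes the graphs with no vertex or one vertex, which
  \<open>path_graph\<close> admits.\<close>

theorem theorem2p10:
  fixes f :: "'a \<Rightarrow> 'a \<Rightarrow> 'a" and one zero :: 'a
  assumes "bounded_semilattice f one zero"
    and "path_graph (semilattice_graph f one zero)"
    and "card (verts (semilattice_graph f one zero)) \<ge> 2"
  shows "K\<^bsub>2\<^esub> (semilattice_graph f one zero) \<or> K\<^bsub>1,2\<^esub> (semilattice_graph f one zero)"
proof -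
  interpret bounded_semilattice f one zero by fact
  from assms(2) obtain vs where graph: "graph \<G>" and vs: "distinct vs" "set vs = verts \<G>"
    and path: "\<And>i j. \<lbrakk>i < length vs; j < length vs\<rbrakk> \<Longrightarrow>
        vs ! i \<rightarrow>\<^bsub>\<G>\<^esub> vs ! j \<longleftrightarrow> j = Suc i \<or> i = Suc j"
    unfolding path_graph_def by blast
  have card: "card (verts \<G>) = length vs"
    using vs distinct_card by metis
  \<comment> \<open>Indexing the edges by their left endpoint, hence the bound
    \<open>length vs - 1\<close>, gives a finite union that unfolds by computation once
    \<open>vs\<close> is an explicit list.\<close>
  have arcs: "arcs_ends \<G> = (\<Union>i<length vs - 1. {(vs ! i, vs ! Suc i), (vs ! Suc i, vs ! i)})"
    (is "_ = ?A")
  proof (intro subset_antisym subrelI)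
    fix x y
    assume xy: "x \<rightarrow>\<^bsub>\<G>\<^esub> y"
    then have "x \<in> set vs" "y \<in> set vs"
      using vs(2) by (auto simp: semilattice_graph_dominates_iff)
    then obtain i j where "i < length vs" "j < length vs" "x = vs ! i" "y = vs ! j"
      by (metis in_set_conv_nth)
    then show "(x, y) \<in> ?A"
      using path[of i j] xy by force
  next
    fix x y
    assume "(x, y) \<in> ?A"
    then obtain i where "i < length vs - 1"
      "x = vs ! i \<and> y = vs ! Suc i \<or> x = vs ! Suc i \<and> y = vs ! i"
      by blast
    then show "x \<rightarrow>\<^bsub>\<G>\<^esub> y"
      using path[of i "Suc i"] path[of "Suc i" i] by auto
  qed
  from path_length_le_3[OF vs path] assms(3) card consider "length vs = 2" | "length vs = 3"
    by linarith
  then show ?thesis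
  proof cases
    case 1
    then obtain a b where ab: "vs = [a, b]"
      by (auto simp: length_Suc_conv numeral_2_eq_2)
    have "arcs_ends \<G> = {(a, b), (b, a)}"
      unfolding arcs ab by (auto simp: lessThan_Suc)
    moreover have "verts \<G> = {a, b}" "a \<noteq> b"
      using vs ab by auto
    ultimately have "K\<^bsub>2\<^esub> \<G>"
      using graph unfolding complete_digraph_def by auto
    then show ?thesis ..
  next
    case 2
    then obtain a b c where abc: "vs = [a, b, c]"
      by (auto simp: length_Suc_conv numeral_3_eq_3)
    \<comment> \<open>The middle vertex \<open>b\<close> forms the part of size one and the two
      endpoints the other part.\<close>
    have "arcs_ends \<G> = {b} \<times> {a, c} \<union> {a, c} \<times> {b}"
      unfolding arcs abc by (auto simp: lessThan_Suc)
    moreover have "verts \<G> = {b} \<union> {a, c}" "{b} \<inter> {a, c} = {}" "card {b} = 1" "card {a, c} = 2"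
      using vs abc by auto
    ultimately have "K\<^bsub>1,2\<^esub> \<G>"
      using graph unfolding complete_bipartite_digraph_def by blast
    then show ?thesis ..
  qed
qed

end
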